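(* Let $n$ be a positive integer and let $\chi:\{0,1,\ldots,n\}\to\{-1,+1\}$ be any $2$-colouring. Then there exist a real number $\alpha>1$ and integers $0\le s\le t$ such that the quasi-progression $Q(\alpha;s,t)$ is contained in $\{0,1,\ldots,n\}$ and has discrepancy at least $\frac{1}{50}n^{1/6}$, i.e. $\left|\sum_{k=s}^{t}\chi(\lfloor k\alpha\rfloor)\right|\ge \frac{1}{50}n^{1/6}$.
   Context: For a real number $\alpha$ and integers $s\le t$, the quasi-progression $Q(\alpha;s,t)$ is the sequence of integers $\lfloor s\alpha\rfloor,\lfloor (s+1)\alpha\rfloor,\ldots,\lfloor t\alpha\rfloor$. The discrepancy of a finite set (or sequence with distinct terms) $S$ under a colouring $\chi$ with values $\pm1$ is $\left|\sum_{x\in S}\chi(x)\right|$. *)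

theory Defs
  imports Complex_Main
begin

text \<open>A quasi-progression is kept as a sequence rather than as a set; its terms are distinct
  whenever \<open>\<alpha> \<ge> 1\<close> (see below).\<close>

definition quasi_progression :: "real \<Rightarrow> int \<Rightarrow> int \<Rightarrow> int list" where
  "quasi_progression \<alpha> s t = map (\<lambda>k. \<lfloor>of_int k * \<alpha>\<rfloor>) [s..t]"

text \<open>The discrepancy is only meant for sequences with distinct terms, where it agrees with the
  discrepancy of the underlying finite set.\<close>

definition discrepancy :: "('a \<Rightarrow> int) \<Rightarrow> 'a list \<Rightarrow> int" where
  "discrepancy \<chi> xs = \<bar>\<Sum>x\<leftarrow>xs. \<chi> x\<bar>"

lemma discrepancy_eq_set:
  "distinct xs \<Longrightarrow> discrepancy \<chi> xs = \<bar>\<Sum>x\<in>set xs. \<chi> x\<bar>"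
  by (simp add: discrepancy_def sum_list_distinct_conv_sum_set)

lemma distinct_quasi_progression:
  assumes "\<alpha> \<ge> 1"
  shows "distinct (quasi_progression \<alpha> s t)"
proof -
  have less: "\<lfloor>of_int j * \<alpha>\<rfloor> < \<lfloor>of_int k * \<alpha>\<rfloor>" if "j < k" for j k :: int
  proof -
    have "real_of_int (k - j) * 1 \<le> of_int (k - j) * \<alpha>"
      using that assms by (intro mult_left_mono) auto
    moreover have "real_of_int (k - j) \<ge> 1"
      using that by linarith
    ultimately have "of_int j * \<alpha> + 1 \<le> of_int k * \<alpha>"
      by (simp add: algebra_simps)
    then show ?thesis by linarith
  qed
  have "inj (\<lambda>k::int. \<lfloor>of_int k * \<alpha>\<rfloor>)"
    by (rule injI) (metis less less_irrefl linorder_neqE)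
  then show ?thesis
    by (auto simp: quasi_progression_def distinct_map intro: inj_on_subset)
qed

lemma discrepancy_quasi_progression:
  "discrepancy \<chi> (quasi_progression \<alpha> s t) = \<bar>\<Sum>k=s..t. \<chi> \<lfloor>of_int k * \<alpha>\<rfloor>\<bar>"
  by (simp add: discrepancy_def quasi_progression_def comp_def interv_sum_list_conv_sum_set_int)

end

theory Submission
  imports Defs "HOL-Analysis.Kronecker_Approximation_Theorem"
begin

text \<open>
  Roth's Fourier argument, restricted to those arithmetic progressions that are quasi-progressions.
  Writing \<open>r \<in> {1..d}\<close> for the residue of \<open>a\<close> modulo \<open>d\<close> and \<open>s = (a - r) / d\<close>, the slope
  \<open>\<alpha> = d + r / s\<close> gives \<open>(s + i) \<alpha> = a + i d + i r / s\<close>, so \<open>a, a + d, \<dots>\<close> is a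
  quasi-progression for its first \<open>m\<close> terms as soon as \<open>m d\<^sup>2 < a\<close>. With lengths at most \<open>L\<close> and
  differences at most \<open>6 L\<close> this covers all progressions above \<open>36 L\<^sup>3\<close>. By Dirichlet's theorem
  every frequency \<open>\<theta>\<close> has a \<open>d \<le> 6 L\<close> for which \<open>d \<theta>\<close> is so close to an integer that the \<open>L\<close>
  exponentials along difference \<open>d\<close> all have real part at least \<open>1/2\<close>. Parseval then shows that
  the mean square of the progression sums is of order at least \<open>L\<close>, and \<open>L\<close> can be taken of order
  \<open>n\<close> to the power \<open>1/3\<close>. The trivial bound \<open>1\<close> suffices for \<open>n\<close> up to the sixth power of \<open>50\<close>.
\<close>

unbundle no vec_syntax \<comment> \<open>frees \<open>\<chi>\<close> for use as a variable\<close>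

section \<open>Fourier analysis modulo \<open>N\<close>\<close>

lemma sum_cis_orthogonality:
  fixes N :: nat and m :: int
  assumes "N > 0"
  shows "(\<Sum>k<N. cis (2 * pi * real k * of_int m / real N)) =
    (if int N dvd m then of_nat N else 0)"
proof -
  define w where "w = cis (2 * pi * of_int m / real N)"
  have pow: "cis (2 * pi * real k * of_int m / real N) = w ^ k" for k
    unfolding w_def Complex.DeMoivre by (rule arg_cong [of _ _ cis]) simp
  have "real N * (2 * pi * of_int m / real N) = 2 * pi * of_int m" using assms by simp
  then have wN: "w ^ N = 1"
    unfolding w_def Complex.DeMoivre by (simp only: cis_multiple_2pi Ints_of_int)
  show ?thesis
  proof (cases "int N dvd m")
    case True
    then obtain q where "m = int N * q" by (elim dvdE)
    then have "2 * pi * of_int m / real N = 2 * pi * of_int q" using assms by simp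
    then have "w = 1" unfolding w_def by (simp only: cis_multiple_2pi Ints_of_int)
    then show ?thesis using True by (simp add: pow)
  next
    case False
    have "w \<noteq> 1"
    proof
      assume "w = 1"
      then have "cos (2 * pi * of_int m / real N) = 1"
        by (simp add: w_def complex_eq_iff)
      then obtain q :: int where "2 * pi * of_int m / real N = of_int q * 2 * pi"
        by (auto simp: cos_one_2pi_int)
      then have "real_of_int m = of_int (q * int N)"
        using assms by (simp add: field_simps)
      then have "m = q * int N" by (simp only: of_int_eq_iff)
      with False show False by simp
    qed
    then have "(\<Sum>k<N. w ^ k) = 0" by (simp add: geometric_sum wN)
    then show ?thesis using False by (simp add: pow)
  qed
qed

text \<open>Hypothesis \<open>incong\<close> lets \<open>A\<close> stand for a set of residues
  modulo \<open>N\<close>, so in the expanded square orthogonality leaves only the diagonal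
  terms.\<close>

lemma parseval_cis:
  fixes N :: nat and f :: "int \<Rightarrow> real"
  assumes "N > 0" and "finite A"
    and incong: "\<And>x y. x \<in> A \<Longrightarrow> y \<in> A \<Longrightarrow> int N dvd x - y \<Longrightarrow> x = y"
  shows "(\<Sum>k<N. (cmod (\<Sum>x\<in>A. of_real (f x) * cis (2 * pi * real k * of_int x / real N)))\<^sup>2)
    = real N * (\<Sum>x\<in>A. (f x)\<^sup>2)"
proof -
  let ?e = "\<lambda>k x. cis (2 * pi * real k * of_int x / real N)"
  have "complex_of_real (\<Sum>k<N. (cmod (\<Sum>x\<in>A. of_real (f x) * ?e k x))\<^sup>2)
      = (\<Sum>k<N. (\<Sum>x\<in>A. of_real (f x) * ?e k x) * cnj (\<Sum>y\<in>A. of_real (f y) * ?e k y))"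
    by (simp only: of_real_sum complex_norm_square)
  also have "\<dots> = (\<Sum>k<N. \<Sum>x\<in>A. \<Sum>y\<in>A. of_real (f x * f y) * ?e k (x - y))"
  proof (intro sum.cong refl)
    fix k
    have "?e k x * cnj (?e k y) = ?e k (x - y)" for x y
      by (simp add: cis_cnj cis_mult right_diff_distrib diff_divide_distrib)
    then have "(of_real (f x) * ?e k x) * (of_real (f y) * cnj (?e k y)) =
        of_real (f x * f y) * ?e k (x - y)" for x y
      by (simp only: of_real_mult) (metis (no_types) mult.assoc mult.left_commute)
    then show "(\<Sum>x\<in>A. of_real (f x) * ?e k x) * cnj (\<Sum>y\<in>A. of_real (f y) * ?e k y) =
        (\<Sum>x\<in>A. \<Sum>y\<in>A. of_real (f x * f y) * ?e k (x - y))"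
      by (simp only: cnj_sum sum_product complex_cnj_mult complex_cnj_complex_of_real)
  qed
  also have "\<dots> = (\<Sum>x\<in>A. \<Sum>k<N. \<Sum>y\<in>A. of_real (f x * f y) * ?e k (x - y))"
    by (rule sum.swap)
  also have "\<dots> = (\<Sum>x\<in>A. \<Sum>y\<in>A. \<Sum>k<N. of_real (f x * f y) * ?e k (x - y))"
    by (intro sum.cong refl sum.swap)
  also have "\<dots> = (\<Sum>x\<in>A. \<Sum>y\<in>A. of_real (f x * f y) * (if int N dvd x - y then of_nat N else 0))"
    by (simp only: sum_distrib_left [symmetric] sum_cis_orthogonality [OF assms(1)])
  also have "\<dots> = (\<Sum>x\<in>A. \<Sum>y\<in>A. if x = y then of_real (f x * f y) * of_nat N else 0)"
    by (intro sum.cong refl) (use incong in auto)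
  also have "\<dots> = (\<Sum>x\<in>A. of_real (f x * f x) * of_nat N)"
    using assms(2) by (simp add: sum.delta)
  also have "\<dots> = complex_of_real (real N * (\<Sum>x\<in>A. (f x)\<^sup>2))"
    by (simp add: sum_distrib_left power2_eq_square mult_ac)
  finally show ?thesis by (simp only: of_real_eq_iff)
qed

section \<open>Second moment of progression sums\<close>

lemma exists_large_cis_sum:
  fixes \<theta> :: real and L :: nat
  assumes "L > 0"
  obtains d where "d \<in> {1..6 * L}"
    and "cmod (\<Sum>i<L. cis (2 * pi * \<theta> * (real i * real d))) \<ge> real L / 2"
proof -
  \<comment> \<open>The denominator bound \<open>6 * L\<close> keeps every
    \<open>i * |\<delta>|\<close> with \<open>i < L\<close> at most 1/6, so all angles stay within
    pi/3, where the cosine is at least 1/2.\<close>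
  from assms have "6 * L > 0" by simp
  then obtain h k where k: "0 < k" "k \<le> int (6 * L)"
      and hk: "\<bar>of_int k * \<theta> - of_int h\<bar> < 1 / real (6 * L)"
    by (rule Dirichlet_approx)
  define d where "d = nat k"
  have d: "d \<in> {1..6 * L}" and kd: "of_int k = real d"
    using k by (auto simp: d_def)
  define \<delta> where "\<delta> = real d * \<theta> - of_int h"
  have \<delta>: "\<bar>\<delta>\<bar> < 1 / real (6 * L)" using hk by (simp add: \<delta>_def kd)
  have "1 / 2 \<le> cos (2 * pi * \<theta> * (real i * real d))" if "i < L" for i
  proof -
    have "2 * pi * \<theta> * (real i * real d) =
        2 * pi * (real i * \<delta>) + 2 * pi * of_int (int i * h)"
      by (simp add: \<delta>_def algebra_simps)
    then have "cos (2 * pi * \<theta> * (real i * real d)) = cos (2 * pi * (real i * \<delta>))"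
      by (simp only: cos_add cos_int_2pin sin_int_2pin)
    also have "\<dots> = cos \<bar>2 * pi * (real i * \<delta>)\<bar>" by (simp only: cos_abs_real)
    also have "cos (pi / 3) \<le> cos \<bar>2 * pi * (real i * \<delta>)\<bar>"
    proof (rule cos_monotone_0_pi_le)
      have "real i * \<bar>\<delta>\<bar> \<le> real L * (1 / real (6 * L))"
        using that \<delta> by (intro mult_mono) auto
      also have "\<dots> = 1 / 6" using assms by simp
      finally show "\<bar>2 * pi * (real i * \<delta>)\<bar> \<le> pi / 3"
        by (simp add: abs_mult)
    qed auto
    finally show ?thesis by (simp add: cos_60)
  qed
  then have "(\<Sum>i<L. 1 / 2) \<le> (\<Sum>i<L. cos (2 * pi * \<theta> * (real i * real d)))"
    by (intro sum_mono) auto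
  also have "\<dots> = Re (\<Sum>i<L. cis (2 * pi * \<theta> * (real i * real d)))" by simp
  also have "\<dots> \<le> cmod (\<Sum>i<L. cis (2 * pi * \<theta> * (real i * real d)))"
    by (rule complex_Re_le_cmod)
  finally show ?thesis using d that by auto
qed

text \<open>For fixed \<open>d\<close> the window sums are a convolution of \<open>f\<close> with a
  progression, so their transform is a product \<open>K d k * F k\<close>. The good \<open>d\<close>
  varies with the frequency \<open>k\<close>; summing over all \<open>d\<close> makes the lower
  bound uniform in \<open>k\<close>.\<close>

lemma ap_sums_second_moment:
  fixes f :: "int \<Rightarrow> real" and L n :: nat
  assumes "L > 0" and supp: "\<And>x. x \<notin> {0..int n} \<Longrightarrow> f x = 0"
  shows "(real L)\<^sup>2 / 4 * (\<Sum>x=0..int n. (f x)\<^sup>2) \<le>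
    (\<Sum>d=1..6 * L. \<Sum>a=- int (6 * L * L)..int n. (\<Sum>i<L. f (a + int i * int d))\<^sup>2)"
proof -
  \<comment> \<open>\<open>N\<close> is the number of integers in \<open>A\<close>, so distinct
    elements of \<open>A\<close> are incongruent and no window wraps around.\<close>
  define N where "N = n + 6 * L * L + 1"
  define A where "A = {- int (6 * L * L)..int n}"
  define e where "e = (\<lambda>k x. cis (2 * pi * real k * of_int x / real N))"
  define F where "F = (\<lambda>k. \<Sum>x\<in>{0..int n}. of_real (f x) * e k x)"
  define S where "S = (\<lambda>d a. \<Sum>i<L. f (a + int i * int d))"
  \<comment> \<open>The minus sign appears because translating \<open>f\<close> by \<open>u\<close>
    multiplies its transform by \<open>e k (- u)\<close>.\<close>
  define K where "K = (\<lambda>d k. \<Sum>i<L. cis (2 * pi * (- real k / real N) * (real i * real d)))"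
  have N: "N > 0" by (simp add: N_def)
  have incong: "x = y" if "x \<in> A" "y \<in> A" "int N dvd x - y" for x y
  proof (rule ccontr)
    assume "x \<noteq> y"
    with that(3) have "int N \<le> \<bar>x - y\<bar>" by (intro zdvd_imp_le) auto
    moreover have "\<bar>x - y\<bar> < int N" using that(1,2) by (auto simp: A_def N_def)
    ultimately show False by simp
  qed
  have sub: "{0..int n} \<subseteq> A" by (simp add: A_def del: of_nat_mult)
  have transform: "(\<Sum>a\<in>A. of_real (S d a) * e k a) = K d k * F k" if "d \<in> {1..6 * L}" for d k
  proof -
    have "(\<Sum>a\<in>A. of_real (f (a + int i * int d)) * e k a) =
        cis (2 * pi * (- real k / real N) * (real i * real d)) * F k" if "i < L" for i
    proof -
      define u where "u = int i * int d"
      \<comment> \<open>Shifts stay below the left margin of \<open>A\<close>, so the translated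
        support lies wholly inside \<open>A\<close> and no term is lost.\<close>
      have "i * d \<le> L * (6 * L)"
        using that \<open>d \<in> _\<close> by (intro mult_mono) auto
      then have "int (i * d) \<le> int (L * (6 * L))" by (simp only: of_nat_le_iff)
      then have u: "0 \<le> u" "u \<le> int (6 * L * L)" by (simp_all add: u_def mult_ac)
      have "(\<Sum>a\<in>A. of_real (f (a + u)) * e k a) =
          (\<Sum>a\<in>{- u..int n - u}. of_real (f (a + u)) * e k a)"
        using u by (intro sum.mono_neutral_right) (auto simp: A_def intro!: supp)
      also have "\<dots> = (\<Sum>x\<in>{0..int n}. of_real (f x) * e k (x - u))"
        by (rule sum.reindex_bij_witness [of _ "\<lambda>x. x - u" "\<lambda>a. a + u"]) auto
      also have "\<dots> = (\<Sum>x\<in>{0..int n}. e k (- u) * (of_real (f x) * e k x))"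
      proof (intro sum.cong refl)
        fix x
        have "e k (x - u) = e k (- u) * e k x"
          by (simp add: e_def cis_mult diff_divide_distrib right_diff_distrib)
        then show "of_real (f x) * e k (x - u) = e k (- u) * (of_real (f x) * e k x)"
          by simp
      qed
      also have "\<dots> = e k (- u) * F k" by (simp add: F_def sum_distrib_left)
      finally show ?thesis by (simp add: e_def u_def mult_ac)
    qed
    then have "(\<Sum>i<L. \<Sum>a\<in>A. of_real (f (a + int i * int d)) * e k a) = K d k * F k"
      by (simp add: K_def sum_distrib_right)
    moreover have "(\<Sum>a\<in>A. of_real (S d a) * e k a) =
        (\<Sum>i<L. \<Sum>a\<in>A. of_real (f (a + int i * int d)) * e k a)"
      by (subst sum.swap) (simp add: S_def sum_distrib_right)
    ultimately show ?thesis by simp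
  qed
  have kernel: "(real L)\<^sup>2 / 4 \<le> (\<Sum>d=1..6 * L. (cmod (K d k))\<^sup>2)" for k
  proof -
    obtain d where d: "d \<in> {1..6 * L}" "real L / 2 \<le> cmod (K d k)"
      using exists_large_cis_sum [OF assms(1), of "- real k / real N"] unfolding K_def by metis
    have "(real L)\<^sup>2 / 4 = (real L / 2)\<^sup>2" by (simp add: power_divide)
    also have "\<dots> \<le> (cmod (K d k))\<^sup>2" using d(2) by (intro power_mono) auto
    also have "\<dots> \<le> (\<Sum>d=1..6 * L. (cmod (K d k))\<^sup>2)"
      using d(1) by (intro member_le_sum) auto
    finally show ?thesis .
  qed
  have "real N * ((real L)\<^sup>2 / 4 * (\<Sum>x=0..int n. (f x)\<^sup>2)) =
      (real L)\<^sup>2 / 4 * (real N * (\<Sum>x=0..int n. (f x)\<^sup>2))"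
    by simp
  also have "real N * (\<Sum>x=0..int n. (f x)\<^sup>2) = (\<Sum>k<N. (cmod (F k))\<^sup>2)"
    unfolding F_def e_def
    by (rule parseval_cis [symmetric, OF N]) (simp, use incong sub in blast)
  also have "(real L)\<^sup>2 / 4 * (\<Sum>k<N. (cmod (F k))\<^sup>2) \<le>
      (\<Sum>k<N. (\<Sum>d=1..6 * L. (cmod (K d k))\<^sup>2) * (cmod (F k))\<^sup>2)"
    unfolding sum_distrib_left by (intro sum_mono mult_right_mono kernel) auto
  also have "\<dots> = (\<Sum>d=1..6 * L. \<Sum>k<N. (cmod (K d k * F k))\<^sup>2)"
    by (subst sum.swap) (simp add: sum_distrib_right norm_mult power_mult_distrib)
  also have "\<dots> = (\<Sum>d=1..6 * L. \<Sum>k<N. (cmod (\<Sum>a\<in>A. of_real (S d a) * e k a))\<^sup>2)"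
    by (simp add: transform)
  also have "\<dots> = (\<Sum>d=1..6 * L. real N * (\<Sum>a\<in>A. (S d a)\<^sup>2))"
    unfolding e_def by (intro sum.cong refl parseval_cis N incong) (auto simp: A_def)
  finally show ?thesis
    using N by (simp add: sum_distrib_left [symmetric] A_def S_def)
qed

section \<open>From window sums to progressions that are quasi-progressions\<close>

lemma ap_is_quasi_progression:
  fixes a :: int and d m :: nat
  assumes "d > 0" and "m > 0" and "int m * int d * int d < a"
  obtains \<alpha> :: real and s :: int where "\<alpha> > 1" and "0 \<le> s"
    and "\<And>i. i < m \<Longrightarrow> \<lfloor>of_int (s + int i) * \<alpha>\<rfloor> = a + int i * int d"
proof -
  \<comment> \<open>Residues run over \<open>1..d\<close> instead of \<open>0..d-1\<close>: then
    \<open>r / s\<close> is positive and the slope exceeds 1 even for \<open>d = 1\<close>.\<close>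
  define r where "r = (a - 1) mod int d + 1"
  define s where "s = (a - 1) div int d"
  have a: "a = s * int d + r" by (simp add: r_def s_def)
  have r: "1 \<le> r" "r \<le> int d" using assms(1) by (auto simp: r_def intro: add1_zle_eq[THEN iffD2])
  have "int m * int d * int d < (s + 1) * int d"
    using assms(3) a r by (simp add: algebra_simps)
  then have s: "int m * int d < s + 1" using assms(1) by (simp only: mult_less_cancel_right)
  have md: "int m * r \<le> int m * int d" using r by (intro mult_left_mono) auto
  have "1 * 1 \<le> int m * int d" using assms by (intro mult_mono) auto
  with s have s0: "s > 0" by linarith
  define \<alpha> where "\<alpha> = real d + of_int r / of_int s"
  show thesis
  proof
    have "of_int r / real_of_int s > 0" using r s0 by simp
    moreover have "real d \<ge> 1" using assms(1) by simp
    ultimately show "\<alpha> > 1" by (simp add: \<alpha>_def)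
    show "0 \<le> s" using s0 by simp
    fix i assume "i < m"
    then have "(int i + 1) * r \<le> int m * r" using r by (intro mult_right_mono) auto
    \<comment> \<open>Here \<open>(i + 1) * r \<le> m * d \<le> s\<close> and
      \<open>r \<ge> 1\<close>, so the error \<open>i * r / s\<close> is a genuine fractional
      part.\<close>
    with md s r have "int i * r < s" by (simp add: algebra_simps)
    then have "real i * of_int r < of_int s"
      by (metis of_int_less_iff of_int_mult of_int_of_nat_eq)
    then have "real i * of_int r / of_int s < 1" using s0 by simp
    moreover have "0 \<le> real i * of_int r / of_int s" using s0 r by simp
    moreover have "of_int (s + int i) * \<alpha> =
        of_int (a + int i * int d) + real i * of_int r / of_int s"
      using s0 by (simp add: \<alpha>_def a field_simps)
    ultimately show "\<lfloor>of_int (s + int i) * \<alpha>\<rfloor> = a + int i * int d" by linarith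
  qed
qed

text \<open>If all window sums were at most \<open>B\<close>, counting the pairs
  \<open>(d, a)\<close> would bound the second moment by the left side of hypothesis
  \<open>B\<close>, against the Fourier lower bound on its right side.\<close>

lemma exists_large_window_sum:
  fixes L n :: nat and \<chi> :: "int \<Rightarrow> int" and B :: real
  assumes "L > 0" and "36 * L ^ 3 \<le> n"
    and \<chi>: "\<forall>x\<in>{0..int n}. \<chi> x \<in> {-1, 1}"
    and "B \<ge> 0"
    and B: "6 * real L * (real n + 6 * real L * real L + 1) * B\<^sup>2 <
      (real L)\<^sup>2 / 4 * (real n - 36 * real L ^ 3)"
  obtains a :: int and d m :: nat where "d \<in> {1..6 * L}" and "0 < m" and "m \<le> L"
    and "36 * int L ^ 3 < a" and "a + int (m - 1) * int d \<le> int n"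
    and "B < \<bar>of_int (\<Sum>i<m. \<chi> (a + int i * int d))\<bar>"
proof -
  define c where "c = 36 * int L ^ 3"
  \<comment> \<open>Deleting the colours up to \<open>36 * L ^ 3\<close> confines the sums to the
    range where progressions are quasi-progressions, at the price of that much norm.\<close>
  define f where "f x = (if c < x \<and> x \<le> int n then real_of_int (\<chi> x) else 0)" for x
  have c: "0 \<le> c" "c \<le> int n"
  proof -
    have "int (36 * L ^ 3) \<le> int n" using assms(2) by (simp only: of_nat_le_iff)
    then show "0 \<le> c" "c \<le> int n" by (simp_all add: c_def)
  qed
  have "(\<Sum>x=0..int n. (f x)\<^sup>2) = (\<Sum>x\<in>{c<..int n}. (f x)\<^sup>2)"
    using c by (intro sum.mono_neutral_right) (auto simp: f_def)
  also have "\<dots> = (\<Sum>x\<in>{c<..int n}. 1)"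
  proof (intro sum.cong refl)
    fix x assume "x \<in> {c<..int n}"
    moreover from this have "\<chi> x \<in> {-1, 1}" using c by (intro \<chi> [rule_format]) simp
    ultimately show "(f x)\<^sup>2 = 1" by (auto simp: f_def)
  qed
  also have "\<dots> = real n - 36 * real L ^ 3"
    using c by (simp add: of_nat_nat) (simp add: c_def)
  finally have norm: "(\<Sum>x=0..int n. (f x)\<^sup>2) = real n - 36 * real L ^ 3" .
  have "\<exists>d\<in>{1..6 * L}. \<exists>a. B < \<bar>\<Sum>i<L. f (a + int i * int d)\<bar>"
  proof (rule ccontr)
    assume "\<not> ?thesis"
    then have le: "\<bar>\<Sum>i<L. f (a + int i * int d)\<bar> \<le> B" if "d \<in> {1..6 * L}" for a d
      using that by (meson not_less)
    have "(real L)\<^sup>2 / 4 * (\<Sum>x=0..int n. (f x)\<^sup>2) \<le>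
        (\<Sum>d=1..6 * L. \<Sum>a=- int (6 * L * L)..int n. (\<Sum>i<L. f (a + int i * int d))\<^sup>2)"
      using c by (intro ap_sums_second_moment assms(1)) (auto simp: f_def)
    also have "\<dots> \<le> (\<Sum>d=1..6 * L. \<Sum>a=- int (6 * L * L)..int n. B\<^sup>2)"
    proof (intro sum_mono)
      fix d a assume "d \<in> {1..6 * L}"
      from power_mono [OF le [OF this, of a] abs_ge_zero, of 2]
      show "(\<Sum>i<L. f (a + int i * int d))\<^sup>2 \<le> B\<^sup>2" by simp
    qed
    also have "\<dots> = 6 * real L * (real n + 6 * real L * real L + 1) * B\<^sup>2"
      by (simp add: of_nat_nat algebra_simps)
    finally show False using B by (simp add: norm)
  qed
  then obtain d a where d: "d \<in> {1..6 * L}" and big: "B < \<bar>\<Sum>i<L. f (a + int i * int d)\<bar>"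
    by blast
  \<comment> \<open>A window may leave the support of \<open>f\<close>. The indices that remain are
    consecutive, so the truncated window is again a progression; it is nonempty since an empty sum
    cannot exceed \<open>B \<ge> 0\<close>.\<close>
  define J where "J = {i. i < L \<and> c < a + int i * int d \<and> a + int i * int d \<le> int n}"
  have "finite J" by (simp add: J_def)
  have sumJ: "(\<Sum>i<L. f (a + int i * int d)) = of_int (\<Sum>i\<in>J. \<chi> (a + int i * int d))"
  proof -
    have "(\<Sum>i<L. f (a + int i * int d)) = (\<Sum>i\<in>J. f (a + int i * int d))"
      by (intro sum.mono_neutral_right) (auto simp: J_def f_def)
    also have "\<dots> = (\<Sum>i\<in>J. of_int (\<chi> (a + int i * int d)))"
      by (intro sum.cong refl) (auto simp: J_def f_def)
    finally show ?thesis by simp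
  qed
  have "J \<noteq> {}" using big assms(4) by (auto simp: sumJ)
  define p where "p = Min J"
  define q where "q = Max J"
  have p: "p \<in> J" and q: "q \<in> J" and pq: "p \<le> q"
    using \<open>finite J\<close> \<open>J \<noteq> {}\<close> by (auto simp: p_def q_def)
  have J: "J = {p..q}"
  proof (intro equalityI subsetI)
    fix i assume "i \<in> J"
    then show "i \<in> {p..q}" using \<open>finite J\<close> by (simp add: p_def q_def)
  next
    fix i assume i: "i \<in> {p..q}"
    then have "int p * int d \<le> int i * int d" "int i * int d \<le> int q * int d"
      by (auto intro!: mult_right_mono)
    then show "i \<in> J" using p q i by (simp add: J_def)
  qed
  show thesis
  proof
    show "d \<in> {1..6 * L}" by (rule d)
    show "0 < q + 1 - p" "q + 1 - p \<le> L" using pq q by (auto simp: J_def)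
    show "36 * int L ^ 3 < a + int p * int d" using p by (simp add: J_def c_def)
    have "a + int p * int d + int (q + 1 - p - 1) * int d = a + int q * int d"
      using pq by (simp add: of_nat_diff algebra_simps)
    then show "a + int p * int d + int (q + 1 - p - 1) * int d \<le> int n"
      using q by (simp add: J_def)
    have "(\<Sum>i\<in>J. \<chi> (a + int i * int d)) = (\<Sum>i<q + 1 - p. \<chi> (a + int p * int d + int i * int d))"
      unfolding J
      by (rule sum.reindex_bij_witness [of _ "\<lambda>i. i + p" "\<lambda>i. i - p"])
        (auto simp: of_nat_diff algebra_simps)
    then show "B < \<bar>of_int (\<Sum>i<q + 1 - p. \<chi> (a + int p * int d + int i * int d))\<bar>"
      using big by (simp add: sumJ)
  qed
qed

section \<open>Choice of parameters\<close>

theorem theorem1: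
  fixes n :: nat and \<chi> :: "int \<Rightarrow> int"
  assumes "n \<ge> 1"
    and "\<forall>x\<in>{0..int n}. \<chi> x \<in> {-1, 1}"
  shows "\<exists>(\<alpha>::real) (s::int) (t::int). \<alpha> > 1 \<and> 0 \<le> s \<and> s \<le> t \<and>
    set (quasi_progression \<alpha> s t) \<subseteq> {0..int n} \<and>
    real_of_int (discrepancy \<chi> (quasi_progression \<alpha> s t)) \<ge> 1 / 50 * real n powr (1 / 6)"
proof (cases "real n powr (1 / 6) \<le> 50")
  case True
  have "\<bar>\<chi> 0\<bar> = 1" using assms(2) by force
  then have "real_of_int (discrepancy \<chi> (quasi_progression 2 0 0)) = 1"
    by (simp add: discrepancy_quasi_progression)
  moreover have "set (quasi_progression 2 0 0) \<subseteq> {0..int n}"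
    by (simp add: quasi_progression_def)
  ultimately show ?thesis
    using True by (intro exI [of _ 2] exI [of _ 0]) simp
next
  case False
  define y where "y = real n powr (1 / 6)"
  have y: "y > 50" using False by (simp add: y_def)
  have "y ^ 6 = real n"
    using assms(1) by (simp add: y_def powr_power)
  \<comment> \<open>With \<open>L\<close> about a tenth of the cube root of \<open>n\<close>, the
    discarded \<open>36 * L ^ 3\<close> is at most 0.036 \<open>n\<close>, while the target
    \<open>(y / 50)\<^sup>2\<close> is only of order \<open>L / 250\<close>.\<close>
  define L where "L = nat \<lfloor>y\<^sup>2 / 10\<rfloor>"
  have y2: "y\<^sup>2 > 2500" using power_strict_mono [of 50 y 2] y by simp
  have L_le: "real L \<le> y\<^sup>2 / 10" and L_ge: "y\<^sup>2 / 10 - 1 \<le> real L"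
    by (auto simp: L_def) linarith
  have L0: "L > 0" using L_ge y2 by linarith
  have n_eq: "real n = (y\<^sup>2) ^ 3" using \<open>y ^ 6 = real n\<close> by (simp flip: power_mult)
  have L3: "real L ^ 3 \<le> real n / 1000"
    using power_mono [OF L_le, of 3] by (simp add: n_eq power_divide)
  have "real (36 * L ^ 3) \<le> real n" using L3 by simp
  then have L3n: "36 * L ^ 3 \<le> n" by (simp only: of_nat_le_iff)
  have bound: "6 * real L * (real n + 6 * real L * real L + 1) * (y / 50)\<^sup>2 <
      (real L)\<^sup>2 / 4 * (real n - 36 * real L ^ 3)"
  proof -
    have L1: "1 \<le> real L" using L0 by simp
    have "real L * real L \<le> real L ^ 3"
      using L1 by (simp add: power3_eq_cube)
    moreover have "1 \<le> real L ^ 3" using L1 by (rule one_le_power)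
    ultimately have "real n + 6 * real L * real L + 1 \<le> 2 * real n"
      using L3 by simp
    \<comment> \<open>Rounding gives \<open>(L + 1) / 250\<close>, and \<open>L \<ge> 1\<close>
      absorbs the 1.\<close>
    moreover have "(y / 50)\<^sup>2 \<le> real L / 125"
      using L_ge L1 by (simp add: power_divide)
    ultimately have "6 * real L * (real n + 6 * real L * real L + 1) * (y / 50)\<^sup>2 \<le>
        6 * real L * (2 * real n) * (real L / 125)"
      by (intro mult_mono) auto
    also have "\<dots> = (real L)\<^sup>2 / 4 * (48 / 125 * real n)"
      by (simp add: power2_eq_square)
    \<comment> \<open>The comparison is 48/125 = 0.384 against at least 0.964.\<close>
    also have "\<dots> < (real L)\<^sup>2 / 4 * (real n - 36 * real L ^ 3)"
      using L3 L0 assms(1) by (intro mult_strict_left_mono) auto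
    finally show ?thesis .
  qed
  have "y / 50 \<ge> 0" using y by simp
  then obtain a d m where d: "d \<in> {1..6 * L}" and m: "0 < m" "m \<le> L"
    and a: "36 * int L ^ 3 < a" "a + int (m - 1) * int d \<le> int n"
    and big: "y / 50 < \<bar>of_int (\<Sum>i<m. \<chi> (a + int i * int d))\<bar>"
    using exists_large_window_sum [OF L0 L3n assms(2) _ bound] by metis
  \<comment> \<open>The cutoff \<open>36 * L ^ 3\<close> was chosen for this worst case of
    \<open>m * d\<^sup>2\<close>.\<close>
  have "int m * int d * int d \<le> int L * int (6 * L) * int (6 * L)"
    using d m by (intro mult_mono) auto
  also have "\<dots> = 36 * int L ^ 3" by (simp add: power3_eq_cube)
  finally obtain \<alpha> :: real and s :: int where \<alpha>: "\<alpha> > 1" and s: "0 \<le> s"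
    and floor: "\<And>i. i < m \<Longrightarrow> \<lfloor>of_int (s + int i) * \<alpha>\<rfloor> = a + int i * int d"
    using ap_is_quasi_progression [of d m a] d m a by auto
  define t where "t = s + int m - 1"
  have floor': "\<lfloor>of_int k * \<alpha>\<rfloor> = a + (k - s) * int d" if "k \<in> {s..t}" for k
    using floor [of "nat (k - s)"] that by (auto simp: t_def)
  have a0: "0 \<le> a" using a(1) by (smt (verit) zero_le_power of_nat_0_le_iff)
  have "set (quasi_progression \<alpha> s t) \<subseteq> {0..int n}"
  proof
    fix x assume "x \<in> set (quasi_progression \<alpha> s t)"
    then obtain k where k: "k \<in> {s..t}" and x: "x = a + (k - s) * int d"
      using floor' by (auto simp: quasi_progression_def)
    have "0 \<le> (k - s) * int d" "(k - s) * int d \<le> int (m - 1) * int d"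
      using k m by (auto simp: t_def intro!: mult_nonneg_nonneg mult_right_mono)
    then show "x \<in> {0..int n}" using a a0 x by auto
  qed
  moreover have "(\<Sum>k=s..t. \<chi> \<lfloor>of_int k * \<alpha>\<rfloor>) = (\<Sum>i<m. \<chi> (a + int i * int d))"
    by (rule sum.reindex_bij_witness [of _ "\<lambda>i. s + int i" "\<lambda>k. nat (k - s)"])
      (use floor' m in \<open>auto simp: t_def\<close>)
  then have "1 / 50 * real n powr (1 / 6) \<le>
      real_of_int (discrepancy \<chi> (quasi_progression \<alpha> s t))"
    using big by (simp add: discrepancy_quasi_progression y_def)
  moreover have "s \<le> t" using m by (simp add: t_def)
  ultimately show ?thesis using \<alpha> s by blast
qed

end
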